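(* Assume that $g$ is convex and that $\beta_1,\dots,\beta_L>0$ satisfy $$\beta_\ell > (K_g+1)\prod_{j=\ell+1}^{L}(1+K_{j-1})\quad\text{for all }\ell\in[L],$$ where $K_g>0$ and $K_1,\dots,K_{L-1}>0$ are constants such that, for every $z=(\theta,u)\in \mathrm{lev}_{\le\Theta(z^0)}\Theta$ and all $d,\bar d\in\mathbb{R}^{\bar N}$ with $d_\theta=\bar d_\theta$, $$|g'(u;d_u)-g'(u;\bar d_u)|\le K_g\|d_u-\bar d_u\|,$$ $$\|\psi_{\ell-1}'(\theta,\mathbf{u}_{\ell-1};d_\theta,d_{\mathbf{u}_{\ell-1}})-\psi_{\ell-1}'(\theta,\mathbf{u}_{\ell-1};\bar d_\theta,\bar d_{\mathbf{u}_{\ell-1}})\|\le K_{\ell-1}\|d_{\mathbf{u}_{\ell-1}}-\bar d_{\mathbf{u}_{\ell-1}}\|,\quad \ell=2,\dots,L.$$ Then for every $\epsilon\in[0,1)$, $$\mathcal{D}_1^{\epsilon}\cap \mathrm{lev}_{\le\Theta(z^0)}\Theta\subseteq\mathcal{SD}_1^{\epsilon}.$$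
   Context: Setting. Let $L,n,N_1,\dots,N_L$ be positive integers, $[L]=\{1,\dots,L\}$, $\bar N_0=0$, $\bar N_\ell=\sum_{j=1}^{\ell}N_j$, $\bar N=n+\bar N_L$. Write $z=(\theta^\top,u_1^\top,\dots,u_L^\top)^\top\in\mathbb{R}^{\bar N}$ with $\theta\in\mathbb{R}^n$, $u_\ell\in\mathbb{R}^{N_\ell}$; $\mathbf{u}_\ell=(u_1^\top,\dots,u_\ell^\top)^\top$, $u=\mathbf{u}_L$, and $\mathbf{u}_0$ is empty. A direction $d\in\mathbb{R}^{\bar N}$ is split in the same way into $d_\theta,d_{u_1},\dots,d_{u_L}$, with $d_{\mathbf{u}_\ell}=(d_{u_1}^\top,\dots,d_{u_\ell}^\top)^\top$, $d_u=d_{\mathbf{u}_L}$. Let $g:\mathbb{R}^{\bar N_L}\to\mathbb{R}_+$ and $\psi_{\ell-1}:\mathbb{R}^{n+\bar N_{\ell-1}}\to\mathbb{R}^{N_\ell}$ ($\ell\in[L]$) be locally Lipschitz continuous and twice directionally differentiable, $\lambda>0$, $\beta_\ell>0$, and $$F(z)=g(u)+\lambda\|\theta\|^2,\qquad \Theta(z)=F(z)+\sum_{\ell=1}^{L}\beta_\ell\|u_\ell-\psi_{\ell-1}(\theta,u_1,\dots,u_{\ell-1})\|_1 .$$ Directional derivatives: $f'(x;d)=\lim_{\tau\downarrow0}\frac{f(x+\tau d)-f(x)}{\tau}$ and $f^{(2)}(x;d)=\lim_{\tau\downarrow0}\frac{f(x+\tau d)-f(x)-\tau f'(x;d)}{\tau^2/2}$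 (componentwise for vector-valued $f$); $f$ is twice directionally differentiable if both limits exist for all $x$ and $d$. Under these assumptions $\Theta$ is twice directionally differentiable on $\mathbb{R}^{\bar N}$. Notation: $\|\cdot\|$ is the Euclidean norm, $\|\cdot\|_1$ the $\ell_1$-norm; empty products equal $1$; $\mathrm{lev}_{\le\gamma}\Theta=\{z:\Theta(z)\le\gamma\}$. The point $z^0=(\mathbf 0,(u_1^0)^\top,\dots,(u_L^0)^\top)^\top$ is defined recursively by $u_\ell^0=\psi_{\ell-1}(\mathbf 0,u_1^0,\dots,u_{\ell-1}^0)$, $\ell\in[L]$. For $\epsilon\ge0$: $\mathcal{D}_1^\epsilon=\{z\in\mathbb{R}^{\bar N}:\Theta'(z;d)\ge-\epsilon\ \text{for all } d \text{ with } \|d\|=1\}$, $\mathcal{SD}_1^\epsilon=\{z\in\mathcal{D}_1^\epsilon:\Theta^{(2)}(z;d)\ge-\epsilon\ \text{for all } d\text{ with }\|d\|=1\text{ and }\Theta'(z;d)=-\epsilon\}$. *)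

theory Defs
  imports "HOL-Analysis.Analysis"
begin

text \<open>
  Encoding. A point is \<open>z = (\<theta>, u)\<close> of type \<open>(real ^ 'n) \<times> (real ^ 'm)\<close>, whose norm is the Euclidean
  norm. The sizes \<open>N\<^sub>1, \<dots>, N\<^sub>L\<close> are carried by a map \<open>blk :: 'm \<Rightarrow> nat\<close> with range \<open>{1..L}\<close> that sends
  a coordinate of \<open>u\<close> to the number of its block, so \<open>N\<^sub>l\<close> is the size of the fibre of \<open>l\<close>.
  The block \<open>u\<^sub>l\<close> and the prefix \<open>(u\<^sub>1, \<dots>, u\<^sub>k)\<close> are vectors of \<open>real ^ 'm\<close> extended by zero
  outside their coordinates.
\<close>

definition block :: "('m::finite \<Rightarrow> nat) \<Rightarrow> nat \<Rightarrow> real ^ 'm \<Rightarrow> real ^ 'm" where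
  "block blk l u = (\<chi> i. if blk i = l then u $ i else 0)"

definition pre :: "('m::finite \<Rightarrow> nat) \<Rightarrow> nat \<Rightarrow> real ^ 'm \<Rightarrow> real ^ 'm" where
  "pre blk k u = (\<chi> i. if blk i \<le> k then u $ i else 0)"

text \<open>The copies of \<open>\<real>\<^bsup>N\<^sub>l\<^esup>\<close> in \<open>real ^ 'm\<close> and of \<open>\<real>\<^bsup>n + N\<^sub>1 + \<dots> + N\<^sub>k\<^esup>\<close> in the space of all \<open>z\<close>.\<close>

definition block_space :: "('m::finite \<Rightarrow> nat) \<Rightarrow> nat \<Rightarrow> (real ^ 'm) set" where
  "block_space blk l = {v. \<forall>i. blk i \<noteq> l \<longrightarrow> v $ i = 0}"

definition pre_space :: "('m::finite \<Rightarrow> nat) \<Rightarrow> nat \<Rightarrow> ((real ^ 'n::finite) \<times> (real ^ 'm)) set" where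
  "pre_space blk k = {(\<theta>, u). \<forall>i. k < blk i \<longrightarrow> u $ i = 0}"

definition l1_norm :: "real ^ 'm::finite \<Rightarrow> real" where
  "l1_norm v = (\<Sum>i\<in>UNIV. \<bar>v $ i\<bar>)"

definition locally_lipschitz_on ::
    "'a::metric_space set \<Rightarrow> ('a \<Rightarrow> 'b::metric_space) \<Rightarrow> bool" where
  "locally_lipschitz_on S f \<longleftrightarrow> (\<forall>x\<in>S. \<exists>r>0. \<exists>C. C-lipschitz_on (ball x r \<inter> S) f)"

definition dir_quot :: "('a::real_normed_vector \<Rightarrow> 'b::real_normed_vector) \<Rightarrow> 'a \<Rightarrow> 'a \<Rightarrow> real \<Rightarrow> 'b" where
  "dir_quot f x d \<tau> = (f (x + \<tau> *\<^sub>R d) - f x) /\<^sub>R \<tau>"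

text \<open>The values of \<open>dir_deriv\<close> and \<open>dir_deriv2\<close> are meaningful only where the limits exist.\<close>

definition dir_deriv :: "('a::real_normed_vector \<Rightarrow> 'b::real_normed_vector) \<Rightarrow> 'a \<Rightarrow> 'a \<Rightarrow> 'b" where
  "dir_deriv f x d = Lim (at_right 0) (dir_quot f x d)"

definition dir_quot2 :: "('a::real_normed_vector \<Rightarrow> 'b::real_normed_vector) \<Rightarrow> 'a \<Rightarrow> 'a \<Rightarrow> real \<Rightarrow> 'b" where
  "dir_quot2 f x d \<tau> = (f (x + \<tau> *\<^sub>R d) - f x - \<tau> *\<^sub>R dir_deriv f x d) /\<^sub>R (\<tau>\<^sup>2 / 2)"

definition dir_deriv2 :: "('a::real_normed_vector \<Rightarrow> 'b::real_normed_vector) \<Rightarrow> 'a \<Rightarrow> 'a \<Rightarrow> 'b" where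
  "dir_deriv2 f x d = Lim (at_right 0) (dir_quot2 f x d)"

text \<open>Directions range over the same set as the points; it is applied to linear subspaces only.\<close>

definition twice_dir_differentiable_on ::
    "'a::real_normed_vector set \<Rightarrow> ('a \<Rightarrow> 'b::real_normed_vector) \<Rightarrow> bool" where
  "twice_dir_differentiable_on V f \<longleftrightarrow>
     (\<forall>x\<in>V. \<forall>d\<in>V. (\<exists>l. (dir_quot f x d \<longlongrightarrow> l) (at_right 0)) \<and>
                 (\<exists>l. (dir_quot2 f x d \<longlongrightarrow> l) (at_right 0)))"

text \<open>The function \<open>\<psi>\<^sub>k\<close> is \<open>\<psi> k\<close>; it is only ever applied to elements of \<open>pre_space blk k\<close>.\<close>

definition penalized ::
    "nat \<Rightarrow> ('m::finite \<Rightarrow> nat) \<Rightarrow> (real ^ 'm \<Rightarrow> real) \<Rightarrow>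
     (nat \<Rightarrow> (real ^ 'n::finite) \<times> (real ^ 'm) \<Rightarrow> real ^ 'm) \<Rightarrow> real \<Rightarrow> (nat \<Rightarrow> real) \<Rightarrow>
     (real ^ 'n) \<times> (real ^ 'm) \<Rightarrow> real" where
  "penalized L blk g \<psi> lam \<beta> = (\<lambda>(\<theta>, u).
     g u + lam * (norm \<theta>)\<^sup>2 +
     (\<Sum>l=1..L. \<beta> l * l1_norm (block blk l u - \<psi> (l - 1) (\<theta>, pre blk (l - 1) u))))"

text \<open>\<open>forward \<psi> k\<close> is the prefix \<open>(u\<^sub>1\<^sup>0, \<dots>, u\<^sub>k\<^sup>0)\<close>: the values of \<open>\<psi> k\<close> lie in block \<open>k + 1\<close>, so
  adding them appends the next block.\<close>

primrec forward ::
    "(nat \<Rightarrow> (real ^ 'n::finite) \<times> (real ^ 'm::finite) \<Rightarrow> real ^ 'm) \<Rightarrow> nat \<Rightarrow> real ^ 'm" where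
  "forward \<psi> 0 = 0"
| "forward \<psi> (Suc k) = forward \<psi> k + \<psi> k (0, forward \<psi> k)"

definition lev :: "('a \<Rightarrow> real) \<Rightarrow> real \<Rightarrow> 'a set" where
  "lev f \<gamma> = {z. f z \<le> \<gamma>}"

definition D1 :: "('a::real_normed_vector \<Rightarrow> real) \<Rightarrow> real \<Rightarrow> 'a set" where
  "D1 f \<epsilon> = {z. \<forall>d. norm d = 1 \<longrightarrow> dir_deriv f z d \<ge> - \<epsilon>}"

definition SD1 :: "('a::real_normed_vector \<Rightarrow> real) \<Rightarrow> real \<Rightarrow> 'a set" where
  "SD1 f \<epsilon> = {z \<in> D1 f \<epsilon>. \<forall>d. norm d = 1 \<and> dir_deriv f z d = - \<epsilon> \<longrightarrow> dir_deriv2 f z d \<ge> - \<epsilon>}"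

lemma forward_in_pre_space:
  fixes \<psi> :: "nat \<Rightarrow> (real ^ 'n::finite) \<times> (real ^ 'm::finite) \<Rightarrow> real ^ 'm"
  assumes \<psi>: "\<forall>k<L. \<forall>z\<in>pre_space blk k. \<psi> k z \<in> block_space blk (Suc k)"
    and "k \<le> L"
  shows "(0 :: real ^ 'n, forward \<psi> k) \<in> pre_space blk k"
  using assms(2)
proof (induction k)
  case 0
  then show ?case by (simp add: pre_space_def)
next
  case (Suc k)
  then have IH: "(0 :: real ^ 'n, forward \<psi> k) \<in> pre_space blk k" by simp
  then have "\<psi> k (0, forward \<psi> k) \<in> block_space blk (Suc k)"
    using \<psi> Suc.prems by (meson Suc_le_eq)
  with IH show ?case by (auto simp: pre_space_def block_space_def)
qed

lemma pre_forward:
  fixes \<psi> :: "nat \<Rightarrow> (real ^ 'n::finite) \<times> (real ^ 'm::finite) \<Rightarrow> real ^ 'm"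
  assumes \<psi>: "\<forall>k<L. \<forall>z\<in>pre_space blk k. \<psi> k z \<in> block_space blk (Suc k)"
    and "k \<le> m" "m \<le> L"
  shows "pre blk k (forward \<psi> m) = forward \<psi> k"
  using assms(2,3)
proof (induction m rule: dec_induct)
  case base
  have "(0 :: real ^ 'n, forward \<psi> k) \<in> pre_space blk k"
    using forward_in_pre_space[OF \<psi>] base by blast
  then show ?case by (auto simp: pre_space_def pre_def vec_eq_iff)
next
  case (step j)
  have "(0 :: real ^ 'n, forward \<psi> j) \<in> pre_space blk j"
    using forward_in_pre_space[OF \<psi>] step by simp
  then have "\<psi> j (0, forward \<psi> j) \<in> block_space blk (Suc j)"
    using \<psi> step.prems by (meson Suc_le_eq)
  then have "pre blk k (forward \<psi> (Suc j)) = pre blk k (forward \<psi> j)"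
    using step.hyps by (auto simp: block_space_def pre_def vec_eq_iff)
  then show ?case using step by simp
qed

text \<open>The recursion \<open>u\<^sub>l\<^sup>0 = \<psi>\<^sub>l\<^sub>-\<^sub>1 (0, u\<^sub>1\<^sup>0, \<dots>, u\<^sub>l\<^sub>-\<^sub>1\<^sup>0)\<close> for the blocks of \<open>forward \<psi> L\<close>, with \<open>l = k + 1\<close>.\<close>

lemma block_forward:
  fixes \<psi> :: "nat \<Rightarrow> (real ^ 'n::finite) \<times> (real ^ 'm::finite) \<Rightarrow> real ^ 'm"
  assumes \<psi>: "\<forall>k<L. \<forall>z\<in>pre_space blk k. \<psi> k z \<in> block_space blk (Suc k)"
    and k: "k < L"
  shows "block blk (Suc k) (forward \<psi> L) = \<psi> k (0, pre blk k (forward \<psi> L))"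
proof -
  have p: "pre blk k (forward \<psi> L) = forward \<psi> k"
    using pre_forward[OF \<psi>, of k L] k by simp
  have q: "pre blk (Suc k) (forward \<psi> L) = forward \<psi> (Suc k)"
    using pre_forward[OF \<psi>, of "Suc k" L] k by simp
  have m: "(0 :: real ^ 'n, forward \<psi> k) \<in> pre_space blk k"
    using forward_in_pre_space[OF \<psi>] k by simp
  then have v: "\<psi> k (0, forward \<psi> k) \<in> block_space blk (Suc k)"
    using \<psi> k by blast
  have "block blk (Suc k) (forward \<psi> L) = block blk (Suc k) (pre blk (Suc k) (forward \<psi> L))"
    by (auto simp: block_def pre_def vec_eq_iff)
  also have "\<dots> = \<psi> k (0, forward \<psi> k)"
    unfolding q using m v by (auto simp: block_def pre_space_def block_space_def vec_eq_iff)
  finally show ?thesis by (simp add: p)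
qed

end

theory Submission imports Defs
begin

text \<open>
  Compare a direction with one whose linearized residuals
  \<open>d\<^sub>l - \<psi>\<^sub>l\<^sub>-\<^sub>1'(d)\<close> are prescribed. As the constraints are triangular, the distance of two directions
  with equal \<open>\<theta>\<close>-part is at most the sum of the differences of their residuals weighted by
  \<open>(1 + K\<^sub>l) \<dots> (1 + K\<^sub>L\<^sub>-\<^sub>1)\<close>, so \<open>\<beta>\<close> makes the penalty outweigh \<open>K\<^sub>g + \<epsilon>\<close> times this distance.
  Shrinking the residuals of the point itself shows that an \<open>\<epsilon>\<close>-stationary point is feasible.
  Correcting a direction of slope \<open>-\<epsilon>\<close> to a tangent one would make the slope too small unless it
  was tangent already. Along a tangent direction the penalty contributes only the nonnegative terms
  \<open>\<beta>\<^sub>l \<parallel>\<psi>\<^sub>l\<^sub>-\<^sub>1\<^sup>(\<^sup>2\<^sup>)\<parallel>\<^sub>1\<close>, and the rest of the second derivative is nonnegative by convexity.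
\<close>

section \<open>Directional derivatives: limits, positive homogeneity, convexity\<close>

lemma dir_deriv_unique:
  "(dir_quot f x d \<longlongrightarrow> l) (at_right 0) \<Longrightarrow> dir_deriv f x d = l"
  unfolding dir_deriv_def by (rule tendsto_Lim) simp_all

lemma dir_deriv2_unique:
  "(dir_quot2 f x d \<longlongrightarrow> l) (at_right 0) \<Longrightarrow> dir_deriv2 f x d = l"
  unfolding dir_deriv2_def by (rule tendsto_Lim) simp_all

lemma tendsto_dir_deriv:
  assumes "twice_dir_differentiable_on V f" "x \<in> V" "d \<in> V"
  shows "(dir_quot f x d \<longlongrightarrow> dir_deriv f x d) (at_right 0)"
  using assms unfolding twice_dir_differentiable_on_def by (metis dir_deriv_unique)

lemma tendsto_dir_deriv2:
  assumes "twice_dir_differentiable_on V f" "x \<in> V" "d \<in> V"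
  shows "(dir_quot2 f x d \<longlongrightarrow> dir_deriv2 f x d) (at_right 0)"
  using assms unfolding twice_dir_differentiable_on_def by (metis dir_deriv2_unique)

lemma dir_deriv_zero [simp]: "dir_deriv f x 0 = 0"
proof (rule dir_deriv_unique)
  have "dir_quot f x 0 = (\<lambda>_. 0)" by (simp add: dir_quot_def fun_eq_iff)
  then show "(dir_quot f x 0 \<longlongrightarrow> 0) (at_right 0)" by simp
qed

text \<open>Positive homogeneity: substitute \<open>c * \<tau>\<close> for \<open>\<tau>\<close>,
  which still tends to 0 from the right because \<open>c > 0\<close>.\<close>

lemma dir_quot_scaleR_tendsto:
  assumes f: "(dir_quot f x d \<longlongrightarrow> l) (at_right 0)" and c: "c > 0"
  shows "(dir_quot f x (c *\<^sub>R d) \<longlongrightarrow> c *\<^sub>R l) (at_right 0)"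
proof -
  have "filterlim (\<lambda>\<tau>. c * \<tau>) (at_right 0) (at_right (0::real))"
    using filterlim_times_pos[OF filterlim_ident, of c 0 0] c by simp
  from filterlim_compose[OF f this]
  have "((\<lambda>\<tau>. c *\<^sub>R dir_quot f x d (c * \<tau>)) \<longlongrightarrow> c *\<^sub>R l) (at_right 0)"
    by (intro tendsto_intros)
  moreover have "c *\<^sub>R dir_quot f x d (c * \<tau>) = dir_quot f x (c *\<^sub>R d) \<tau>" for \<tau>
    using c by (simp add: dir_quot_def mult.commute)
  ultimately show ?thesis by simp
qed

text \<open>Membership in \<open>D1\<close> constrains unit directions only; homogeneity carries the
  bound over to test directions of any length.\<close>

lemma D1_lower_bound:
  assumes z: "z \<in> D1 f \<epsilon>" and l: "(dir_quot f z d \<longlongrightarrow> l) (at_right 0)"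
  shows "- \<epsilon> * norm d \<le> dir_deriv f z d"
proof (cases "d = 0")
  case False
  have "- \<epsilon> \<le> dir_deriv f z ((1 / norm d) *\<^sub>R d)"
    using z False by (simp add: D1_def)
  also have "\<dots> = (1 / norm d) *\<^sub>R l"
    using dir_quot_scaleR_tendsto[OF l, of "1 / norm d"] False by (intro dir_deriv_unique) simp
  finally show ?thesis
    using False dir_deriv_unique[OF l] by (simp add: field_simps)
qed simp

text \<open>Difference quotients of a convex function increase with the step, so their limit at 0
  lies below each of them. Hence every second-order quotient is nonnegative.\<close>

lemma convex_on_dir_deriv2_nonneg:
  fixes f :: "'a::real_normed_vector \<Rightarrow> real"
  assumes f: "convex_on UNIV f" and diff: "twice_dir_differentiable_on UNIV f"
  shows "0 \<le> dir_deriv2 f x d"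
proof -
  have mono: "dir_quot f x d s \<le> dir_quot f x d t" if "0 < s" "s \<le> t" for s t
  proof -
    have "f ((1 - s / t) *\<^sub>R x + (s / t) *\<^sub>R (x + t *\<^sub>R d)) \<le> (1 - s / t) * f x + (s / t) * f (x + t *\<^sub>R d)"
      using that by (intro convex_onD[OF f]) auto
    moreover have "(1 - s / t) *\<^sub>R x + (s / t) *\<^sub>R (x + t *\<^sub>R d) = x + s *\<^sub>R d"
      using that by (simp add: algebra_simps)
    ultimately show ?thesis
      using that by (simp add: dir_quot_def field_simps)
  qed
  have le: "dir_deriv f x d \<le> dir_quot f x d t" if "0 < t" for t
  proof (rule tendsto_upperbound)
    show "(dir_quot f x d \<longlongrightarrow> dir_deriv f x d) (at_right 0)"
      by (rule tendsto_dir_deriv[OF diff]) auto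
    show "\<forall>\<^sub>F s in at_right 0. dir_quot f x d s \<le> dir_quot f x d t"
      using that mono by (auto simp: eventually_at_right_field intro!: exI[of _ t])
  qed simp
  show ?thesis
  proof (rule tendsto_lowerbound)
    show "(dir_quot2 f x d \<longlongrightarrow> dir_deriv2 f x d) (at_right 0)"
      by (rule tendsto_dir_deriv2[OF diff]) auto
    have "0 \<le> dir_quot2 f x d t" if "0 < t" for t
      using le[OF that] that by (simp add: dir_quot_def dir_quot2_def field_simps)
    then show "\<forall>\<^sub>F t in at_right 0. 0 \<le> dir_quot2 f x d t"
      by (auto simp: eventually_at_right_field intro!: exI[of _ 1])
  qed simp
qed

section \<open>Blocks and prefixes of coordinates\<close>

lemma block_in_block_space: "block blk l u \<in> block_space blk l"
  by (simp add: block_def block_space_def)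

lemma subspace_block_space: "subspace (block_space blk l)"
  by (auto simp: subspace_def block_space_def)

lemma pre_in_pre_space: "(a, pre blk k u) \<in> pre_space blk k"
  by (simp add: pre_space_def pre_def)

lemma pre_0:
  assumes "range blk = {1..L}"
  shows "pre blk 0 u = 0"
proof -
  have nz: "blk i \<noteq> 0" for i using assms by (metis atLeastAtMost_iff not_one_le_zero rangeI)
  show ?thesis by (simp add: nz pre_def vec_eq_iff)
qed

lemma pre_all:
  assumes "range blk = {1..L}"
  shows "pre blk L u = u"
proof -
  have "blk i \<le> L" for i using assms by (metis atLeastAtMost_iff rangeI)
  then show ?thesis by (simp add: pre_def vec_eq_iff)
qed

lemma pre_Suc: "pre blk (Suc k) u = pre blk k u + block blk (Suc k) u"
  by (auto simp: pre_def block_def vec_eq_iff)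

lemma block_add_scaleR: "block blk k (u + t *\<^sub>R v) = block blk k u + t *\<^sub>R block blk k v"
  by (simp add: block_def vec_eq_iff)

lemma pre_add_scaleR: "pre blk k (u + t *\<^sub>R v) = pre blk k u + t *\<^sub>R pre blk k v"
  by (simp add: pre_def vec_eq_iff)

lemma norm_le_l1_norm: "norm v \<le> l1_norm v"
  unfolding l1_norm_def by (rule norm_le_l1_cart)

lemma l1_norm_nonneg: "0 \<le> l1_norm v"
  by (simp add: l1_norm_def sum_nonneg)

text \<open>Difference quotients stay in the block space, a subspace that is closed by finite
  dimension. The set \<open>V\<close> keeps all evaluation points where the range of
  \<open>f\<close> is known.\<close>

lemma dir_deriv_in_block_space:
  assumes lim: "(dir_quot f x d \<longlongrightarrow> l) (at_right 0)"
    and f: "\<And>y. y \<in> V \<Longrightarrow> f y \<in> block_space blk k"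
    and V: "subspace V" "x \<in> V" "d \<in> V"
  shows "l \<in> block_space blk k"
proof (rule Lim_in_closed_set[OF _ _ _ lim])
  show "closed (block_space blk k)" by (rule closed_subspace[OF subspace_block_space])
  have "dir_quot f x d t \<in> block_space blk k" for t
    unfolding dir_quot_def using V f
    by (intro subspace_scale subspace_diff subspace_add subspace_block_space) (auto intro: subspace_add subspace_scale)
  then show "\<forall>\<^sub>F t in at_right 0. dir_quot f x d t \<in> block_space blk k" by simp
qed simp

lemma subspace_pre_space: "subspace (pre_space blk k)"
  by (auto simp: subspace_def pre_space_def zero_prod_def)

section \<open>Triangular systems: solvability and stability\<close>

text \<open>Forward substitution: equation \<open>l\<close> sees earlier blocks only, so the blocks
  can be fixed one after another. It supplies directions with prescribed linearized
  residuals.\<close>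

lemma triangular_system_solvable:
  fixes \<phi> :: "nat \<Rightarrow> real ^ 'm::finite \<Rightarrow> real ^ 'm"
  assumes \<phi>: "\<And>l x. l \<in> {1..L} \<Longrightarrow> \<phi> l (pre blk (l - 1) x) \<in> block_space blk l"
  obtains v where "\<And>l. l \<in> {1..L} \<Longrightarrow> block blk l v = \<phi> l (pre blk (l - 1) v)"
proof -
  have "\<exists>v. \<forall>l\<in>{1..k}. block blk l v = \<phi> l (pre blk (l - 1) v)" if "k \<le> L" for k
    using that
  proof (induction k)
    case (Suc k)
    then obtain v where v: "\<forall>l\<in>{1..k}. block blk l v = \<phi> l (pre blk (l - 1) v)" by auto
    define p where "p = \<phi> (Suc k) (pre blk k v)"
    have p: "p \<in> block_space blk (Suc k)"
      using \<phi>[of "Suc k" v] Suc.prems by (simp add: p_def)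
    \<comment> \<open>Truncating \<open>v\<close> first clears block \<open>Suc k\<close>, which
      then becomes exactly \<open>p\<close>; the earlier equations are unaffected.\<close>
    define v' where "v' = pre blk k v + p"
    have pre: "pre blk j v' = pre blk j v" if "j \<le> k" for j
      using that p by (auto simp: v'_def pre_def block_space_def vec_eq_iff)
    have "block blk l v' = block blk l v" if "l \<le> k" for l
      using that p by (auto simp: v'_def pre_def block_def block_space_def vec_eq_iff)
    moreover have "block blk (Suc k) v' = p"
      using p by (auto simp: v'_def pre_def block_def block_space_def vec_eq_iff)
    ultimately have "block blk l v' = \<phi> l (pre blk (l - 1) v')" if "l \<in> {1..Suc k}" for l
      using that v pre by (cases "l = Suc k") (auto simp: p_def)
    then show ?case by blast
  qed simp
  then show ?thesis using that by blast
qed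

text \<open>A discrete Gronwall argument: the distance of the prefixes grows at step
  \<open>k\<close> by at most the factor \<open>1 + K k\<close> plus the new residual difference;
  unrolling gives the products.\<close>

lemma triangular_system_stable:
  fixes \<phi> :: "nat \<Rightarrow> real ^ 'm::finite \<Rightarrow> real ^ 'm"
  assumes blk: "range blk = {1..L}"
    and K: "\<And>k. k \<in> {1..L - 1} \<Longrightarrow> 0 \<le> K k"
    and lip: "\<And>l. l \<in> {2..L} \<Longrightarrow>
      norm (\<phi> l (pre blk (l - 1) v) - \<phi> l (pre blk (l - 1) v'))
        \<le> K (l - 1) * norm (pre blk (l - 1) v - pre blk (l - 1) v')"
  shows "norm (v - v') \<le> (\<Sum>l=1..L. (\<Prod>j=l+1..L. 1 + K (j - 1)) *
    norm ((block blk l v - \<phi> l (pre blk (l - 1) v)) - (block blk l v' - \<phi> l (pre blk (l - 1) v'))))"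
proof -
  define r where "r l = (block blk l v - \<phi> l (pre blk (l - 1) v)) -
    (block blk l v' - \<phi> l (pre blk (l - 1) v'))" for l
  let ?B = "\<lambda>k. \<Sum>l=1..k. (\<Prod>j=l+1..k. 1 + K (j - 1)) * norm (r l)"
  have "norm (pre blk k v - pre blk k v') \<le> ?B k" if "k \<le> L" for k
    using that
  proof (induction k)
    case 0
    then show ?case by (simp add: pre_0[OF blk])
  next
    case (Suc k)
    let ?S = "norm (pre blk k v - pre blk k v')"
    \<comment> \<open>Nothing is assumed about \<open>K 0\<close>: for \<open>k = 0\<close> both
      prefixes are 0 and so is the difference.\<close>
    have lip': "norm (\<phi> (Suc k) (pre blk k v) - \<phi> (Suc k) (pre blk k v')) \<le> K k * ?S"
      using lip[of "Suc k"] Suc.prems by (cases "k = 0") (auto simp: pre_0[OF blk])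
    have "pre blk (Suc k) v - pre blk (Suc k) v' =
        (pre blk k v - pre blk k v') + r (Suc k) +
        (\<phi> (Suc k) (pre blk k v) - \<phi> (Suc k) (pre blk k v'))"
      by (simp add: r_def pre_Suc)
    then have "norm (pre blk (Suc k) v - pre blk (Suc k) v') \<le> ?S + norm (r (Suc k)) + K k * ?S"
      using lip' by (metis norm_triangle_le add_mono norm_triangle_ineq)
    also have "\<dots> \<le> (1 + K k) * ?B k + norm (r (Suc k))"
    proof (cases "k = 0")
      case False
      then have "(1 + K k) * ?S \<le> (1 + K k) * ?B k"
        using K[of k] Suc by (intro mult_left_mono) auto
      then show ?thesis by (simp add: algebra_simps)
    qed (simp add: pre_0[OF blk])
    also have "\<dots> = ?B (Suc k)"
    proof -
      \<comment> \<open>Each old weight gains the factor \<open>1 + K k\<close>, while the new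
        residual enters with the empty product 1.\<close>
      have "(\<Prod>j=l+1..Suc k. 1 + K (j - 1)) = (\<Prod>j=l+1..k. 1 + K (j - 1)) * (1 + K k)"
        if "l \<in> {1..k}" for l
        using that by (simp add: prod.cl_ivl_Suc)
      then show ?thesis by (simp add: sum_distrib_left mult_ac)
    qed
    finally show ?case .
  qed
  from this[of L] show ?thesis by (simp add: pre_all[OF blk] r_def)
qed

text \<open>The mechanism of exact penalization: since the Euclidean norm is at most the l1 norm and
  \<open>c < \<beta>\<close> strictly, a single nonzero residual would reverse the
  inequality.\<close>

lemma l1_penalty_dominates:
  fixes r :: "nat \<Rightarrow> real ^ 'm::finite"
  assumes c: "\<And>l. l \<in> A \<Longrightarrow> c l < \<beta> l" and \<beta>: "\<And>l. l \<in> A \<Longrightarrow> 0 \<le> \<beta> l" and A: "finite A"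
    and le: "(\<Sum>l\<in>A. \<beta> l * l1_norm (r l)) \<le> (\<Sum>l\<in>A. c l * norm (r l))"
    and l: "l \<in> A"
  shows "r l = 0"
proof (rule ccontr)
  assume nz: "r l \<noteq> 0"
  have "(\<Sum>l\<in>A. c l * norm (r l)) < (\<Sum>l\<in>A. \<beta> l * norm (r l))"
  proof (rule sum_strict_mono_ex1[OF A])
    show "\<forall>x\<in>A. c x * norm (r x) \<le> \<beta> x * norm (r x)"
      using c by (auto intro!: mult_right_mono simp: less_imp_le)
    show "\<exists>x\<in>A. c x * norm (r x) < \<beta> x * norm (r x)"
      using c l nz by (intro bexI[of _ l]) auto
  qed
  also have "\<dots> \<le> (\<Sum>l\<in>A. \<beta> l * l1_norm (r l))"
    using \<beta> by (intro sum_mono mult_left_mono norm_le_l1_norm)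
  finally show False using le by simp
qed

section \<open>First and second directional derivatives of the penalized objective\<close>

text \<open>A chain rule for the absolute value along a curve whose slope \<open>q t\<close> may
  vary: at \<open>w = 0\<close> the factor \<open>t\<close> pulls out, and elsewhere the sign is
  eventually constant.\<close>

lemma tendsto_abs_dir_quot:
  fixes q :: "real \<Rightarrow> real"
  assumes q: "(q \<longlongrightarrow> \<rho>) (at_right 0)"
  shows "((\<lambda>t. (\<bar>w + t * q t\<bar> - \<bar>w\<bar>) / t) \<longlongrightarrow> (if w = 0 then \<bar>\<rho>\<bar> else sgn w * \<rho>)) (at_right 0)"
proof (cases "w = 0")
  case True
  have "((\<lambda>t. \<bar>q t\<bar>) \<longlongrightarrow> \<bar>\<rho>\<bar>) (at_right 0)" using q by (rule tendsto_rabs)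
  moreover have "\<forall>\<^sub>F t in at_right 0. \<bar>q t\<bar> = (\<bar>w + t * q t\<bar> - \<bar>w\<bar>) / t"
    using True by (auto simp: eventually_at_right_field abs_mult intro!: exI[of _ 1])
  ultimately show ?thesis using True by (simp add: tendsto_cong)
next
  case False
  \<comment> \<open>The product tends to the square of \<open>w\<close>, so \<open>w\<close> and the
    perturbed value eventually have the same sign.\<close>
  have "((\<lambda>t. w * (w + t * q t)) \<longlongrightarrow> w * (w + 0 * \<rho>)) (at_right 0)"
    using q by (intro tendsto_intros)
  moreover have "0 < w * (w + 0 * \<rho>)"
    using False by (simp add: zero_less_mult_iff) linarith
  ultimately have "\<forall>\<^sub>F t in at_right 0. 0 < w * (w + t * q t)"
    by (rule order_tendstoD(1))
  moreover have "\<forall>\<^sub>F t in at_right (0::real). 0 < t"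
    by (rule eventually_at_right_less)
  ultimately have "\<forall>\<^sub>F t in at_right 0. sgn w * q t = (\<bar>w + t * q t\<bar> - \<bar>w\<bar>) / t"
  proof eventually_elim
    case (elim t)
    then consider "0 < w" "0 < w + t * q t" | "w < 0" "w + t * q t < 0"
      unfolding zero_less_mult_iff by blast
    then show ?case using elim(2) by cases simp_all
  qed
  moreover have "((\<lambda>t. sgn w * q t) \<longlongrightarrow> sgn w * \<rho>) (at_right 0)"
    using q by (intro tendsto_intros)
  ultimately show ?thesis using False by (simp add: tendsto_cong)
qed

lemma tendsto_dir_quot_penalized:
  fixes \<psi> :: "nat \<Rightarrow> (real ^ 'n::finite) \<times> (real ^ 'm::finite) \<Rightarrow> real ^ 'm"
  assumes g: "(dir_quot g u v \<longlongrightarrow> g') (at_right 0)"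
    and \<psi>: "\<And>l. l \<in> {1..L} \<Longrightarrow>
      (dir_quot (\<psi> (l - 1)) (\<theta>, pre blk (l - 1) u) (a, pre blk (l - 1) v) \<longlongrightarrow> \<psi>' l) (at_right 0)"
  shows "(dir_quot (penalized L blk g \<psi> lam \<beta>) (\<theta>, u) (a, v) \<longlongrightarrow>
    g' + lam * (2 * (\<theta> \<bullet> a)) + (\<Sum>l=1..L. \<beta> l * (\<Sum>i\<in>UNIV.
      let w = (block blk l u - \<psi> (l - 1) (\<theta>, pre blk (l - 1) u)) $ i;
          \<rho> = (block blk l v - \<psi>' l) $ i
      in if w = 0 then \<bar>\<rho>\<bar> else sgn w * \<rho>))) (at_right 0)"
proof -
  define Q where "Q l = dir_quot (\<psi> (l - 1)) (\<theta>, pre blk (l - 1) u) (a, pre blk (l - 1) v)" for l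
  define w where "w l = block blk l u - \<psi> (l - 1) (\<theta>, pre blk (l - 1) u)" for l
  define q where "q l t = block blk l v - Q l t" for l t
  have q: "((\<lambda>t. q l t $ i) \<longlongrightarrow> (block blk l v - \<psi>' l) $ i) (at_right 0)" if "l \<in> {1..L}" for l i
    unfolding q_def Q_def using \<psi>[OF that] by (intro tendsto_intros)
  \<comment> \<open>An identity without remainder, because \<open>q\<close> contains the difference
    quotient instead of its limit.\<close>
  have w: "block blk l (u + t *\<^sub>R v) - \<psi> (l - 1) (\<theta> + t *\<^sub>R a, pre blk (l - 1) (u + t *\<^sub>R v))
      = w l + t *\<^sub>R q l t" if "0 < t" for l t
    using that by (simp add: w_def q_def Q_def dir_quot_def block_add_scaleR pre_add_scaleR algebra_simps)
  let ?R = "\<lambda>t. dir_quot g u v t + lam * (2 * (\<theta> \<bullet> a) + t * (a \<bullet> a)) +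
    (\<Sum>l=1..L. \<beta> l * (\<Sum>i\<in>UNIV. (\<bar>w l $ i + t * q l t $ i\<bar> - \<bar>w l $ i\<bar>) / t))"
  have eq: "dir_quot (penalized L blk g \<psi> lam \<beta>) (\<theta>, u) (a, v) t = ?R t" if t: "0 < t" for t
  proof -
    have s: "(\<Sum>l=1..L. \<beta> l * (\<Sum>i\<in>UNIV. (\<bar>w l $ i + t * q l t $ i\<bar> - \<bar>w l $ i\<bar>) / t)) =
       ((\<Sum>l=1..L. \<beta> l * l1_norm (w l + t *\<^sub>R q l t)) - (\<Sum>l=1..L. \<beta> l * l1_norm (w l))) / t"
      by (simp add: l1_norm_def sum_subtractf sum_divide_distrib[symmetric] right_diff_distrib
          diff_divide_distrib)
    have n: "(norm (\<theta> + t *\<^sub>R a))\<^sup>2 = (norm \<theta>)\<^sup>2 + t * (2 * (\<theta> \<bullet> a) + t * (a \<bullet> a))"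
      unfolding power2_norm_eq_inner by (simp add: inner_add inner_commute algebra_simps)
    have p0: "penalized L blk g \<psi> lam \<beta> (\<theta>, u) =
      g u + lam * (norm \<theta>)\<^sup>2 + (\<Sum>l=1..L. \<beta> l * l1_norm (w l))"
      by (simp add: penalized_def w_def)
    have p1: "penalized L blk g \<psi> lam \<beta> ((\<theta>, u) + t *\<^sub>R (a, v)) =
      g (u + t *\<^sub>R v) + lam * ((norm \<theta>)\<^sup>2 + t * (2 * (\<theta> \<bullet> a) + t * (a \<bullet> a))) +
      (\<Sum>l=1..L. \<beta> l * l1_norm (w l + t *\<^sub>R q l t))"
      unfolding penalized_def by (simp only: add_Pair scaleR_Pair prod.case w[OF t] n)
    show ?thesis
      unfolding s dir_quot_def[of "penalized L blk g \<psi> lam \<beta>"] dir_quot_def[of g] p0 p1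
      using t by (simp add: field_simps)
  qed
  have "(?R \<longlongrightarrow> g' + lam * (2 * (\<theta> \<bullet> a) + 0 * (a \<bullet> a)) + (\<Sum>l=1..L. \<beta> l * (\<Sum>i\<in>UNIV.
      if w l $ i = 0 then \<bar>(block blk l v - \<psi>' l) $ i\<bar> else sgn (w l $ i) * (block blk l v - \<psi>' l) $ i)))
      (at_right 0)"
    by (intro tendsto_intros g tendsto_abs_dir_quot q)
  moreover have "\<forall>\<^sub>F t in at_right 0. ?R t = dir_quot (penalized L blk g \<psi> lam \<beta>) (\<theta>, u) (a, v) t"
    using eventually_at_right_less[of "0::real"] by eventually_elim (simp add: eq)
  ultimately show ?thesis
    unfolding Let_def w_def[symmetric] by (auto dest: Lim_transform_eventually)
qed

text \<open>Feasibility cancels the residual to order zero and tangency to order one. The rest is a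
  multiple of the second-order quotient of \<open>\<psi>\<close>, and the l1 norm turns its factor
  into \<open>t\<^sup>2 / 2\<close>, the denominator of \<open>dir_quot2\<close>.\<close>

lemma tendsto_dir_quot2_penalized:
  fixes \<psi> :: "nat \<Rightarrow> (real ^ 'n::finite) \<times> (real ^ 'm::finite) \<Rightarrow> real ^ 'm"
  assumes g: "twice_dir_differentiable_on UNIV g"
    and \<psi>: "\<And>l. l \<in> {1..L} \<Longrightarrow> twice_dir_differentiable_on (pre_space blk (l - 1)) (\<psi> (l - 1))"
    and feasible: "\<And>l. l \<in> {1..L} \<Longrightarrow> block blk l u = \<psi> (l - 1) (\<theta>, pre blk (l - 1) u)"
    and tangent: "\<And>l. l \<in> {1..L} \<Longrightarrow>
      block blk l v = dir_deriv (\<psi> (l - 1)) (\<theta>, pre blk (l - 1) u) (a, pre blk (l - 1) v)"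
  shows "(dir_quot2 (penalized L blk g \<psi> lam \<beta>) (\<theta>, u) (a, v) \<longlongrightarrow>
    dir_deriv2 g u v + lam * (2 * (a \<bullet> a)) + (\<Sum>l=1..L. \<beta> l *
      l1_norm (dir_deriv2 (\<psi> (l - 1)) (\<theta>, pre blk (l - 1) u) (a, pre blk (l - 1) v)))) (at_right 0)"
proof -
  define Q where "Q l = dir_quot2 (\<psi> (l - 1)) (\<theta>, pre blk (l - 1) u) (a, pre blk (l - 1) v)" for l
  define D where "D l = dir_deriv2 (\<psi> (l - 1)) (\<theta>, pre blk (l - 1) u) (a, pre blk (l - 1) v)" for l
  have Q: "(Q l \<longlongrightarrow> D l) (at_right 0)" if "l \<in> {1..L}" for l
    unfolding Q_def D_def by (rule tendsto_dir_deriv2[OF \<psi>[OF that]]) (rule pre_in_pre_space)+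
  have l1: "((\<lambda>t. l1_norm (Q l t)) \<longlongrightarrow> l1_norm (D l)) (at_right 0)" if "l \<in> {1..L}" for l
    unfolding l1_norm_def using Q[OF that] by (intro tendsto_intros)
  have d: "dir_deriv (penalized L blk g \<psi> lam \<beta>) (\<theta>, u) (a, v) = dir_deriv g u v + lam * (2 * (\<theta> \<bullet> a))"
  proof -
    have "(dir_quot (penalized L blk g \<psi> lam \<beta>) (\<theta>, u) (a, v) \<longlongrightarrow>
      dir_deriv g u v + lam * (2 * (\<theta> \<bullet> a)) + (\<Sum>l=1..L. \<beta> l * (\<Sum>i\<in>UNIV.
        let w = (block blk l u - \<psi> (l - 1) (\<theta>, pre blk (l - 1) u)) $ i;
            \<rho> = (block blk l v - dir_deriv (\<psi> (l - 1)) (\<theta>, pre blk (l - 1) u) (a, pre blk (l - 1) v)) $ i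
        in if w = 0 then \<bar>\<rho>\<bar> else sgn w * \<rho>))) (at_right 0)"
      by (intro tendsto_dir_quot_penalized tendsto_dir_deriv[OF g] tendsto_dir_deriv[OF \<psi>]
          pre_in_pre_space UNIV_I)
    from dir_deriv_unique[OF this] show ?thesis
      using feasible tangent by simp
  qed
  have r: "block blk l (u + t *\<^sub>R v) - \<psi> (l - 1) (\<theta> + t *\<^sub>R a, pre blk (l - 1) (u + t *\<^sub>R v))
      = (- (t\<^sup>2 / 2)) *\<^sub>R Q l t" if "0 < t" "l \<in> {1..L}" for l t
    using that by (simp add: Q_def dir_quot2_def block_add_scaleR pre_add_scaleR feasible tangent
        flip: scaleR_minus_left)
  have l1s: "l1_norm ((- (t\<^sup>2 / 2)) *\<^sub>R x) = t\<^sup>2 / 2 * l1_norm x" for t and x :: "real ^ 'm"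
    by (simp add: l1_norm_def abs_mult sum_distrib_left)
  let ?R = "\<lambda>t. dir_quot2 g u v t + lam * (2 * (a \<bullet> a)) + (\<Sum>l=1..L. \<beta> l * l1_norm (Q l t))"
  have eq: "dir_quot2 (penalized L blk g \<psi> lam \<beta>) (\<theta>, u) (a, v) t = ?R t" if t: "0 < t" for t
  proof -
    have n: "(norm (\<theta> + t *\<^sub>R a))\<^sup>2 = (norm \<theta>)\<^sup>2 + t * (2 * (\<theta> \<bullet> a)) + t\<^sup>2 * (a \<bullet> a)"
      unfolding power2_norm_eq_inner
      by (simp add: inner_add inner_commute algebra_simps power2_eq_square)
    have p0: "penalized L blk g \<psi> lam \<beta> (\<theta>, u) = g u + lam * (norm \<theta>)\<^sup>2"
      using feasible by (simp add: penalized_def l1_norm_def)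
    have "(\<Sum>l=1..L. \<beta> l * l1_norm (block blk l (u + t *\<^sub>R v) -
        \<psi> (l - 1) (\<theta> + t *\<^sub>R a, pre blk (l - 1) (u + t *\<^sub>R v)))) =
      (\<Sum>l=1..L. \<beta> l * (t\<^sup>2 / 2 * l1_norm (Q l t)))"
      using r[OF t] by (intro sum.cong) (simp_all only: l1s)
    also have "\<dots> = t\<^sup>2 / 2 * (\<Sum>l=1..L. \<beta> l * l1_norm (Q l t))"
      by (simp add: sum_distrib_left mult_ac)
    finally have p1: "penalized L blk g \<psi> lam \<beta> ((\<theta>, u) + t *\<^sub>R (a, v)) =
      g (u + t *\<^sub>R v) + lam * ((norm \<theta>)\<^sup>2 + t * (2 * (\<theta> \<bullet> a)) + t\<^sup>2 * (a \<bullet> a)) +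
      t\<^sup>2 / 2 * (\<Sum>l=1..L. \<beta> l * l1_norm (Q l t))"
      by (simp add: penalized_def n)
    show ?thesis
      unfolding dir_quot2_def[of "penalized L blk g \<psi> lam \<beta>"] dir_quot2_def[of g] p0 p1 d
      using t by (simp add: field_simps)
  qed
  have "(?R \<longlongrightarrow> dir_deriv2 g u v + lam * (2 * (a \<bullet> a)) + (\<Sum>l=1..L. \<beta> l * l1_norm (D l))) (at_right 0)"
    by (intro tendsto_intros tendsto_dir_deriv2[OF g] l1 UNIV_I)
  moreover have "\<forall>\<^sub>F t in at_right 0. ?R t = dir_quot2 (penalized L blk g \<psi> lam \<beta>) (\<theta>, u) (a, v) t"
    using eventually_at_right_less[of "0::real"] by eventually_elim (simp add: eq)
  ultimately show ?thesis
    unfolding D_def by (rule Lim_transform_eventually)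
qed

section \<open>Feasibility, tangency and the second-order condition\<close>

theorem theorem2p2:
  fixes L :: nat
    and blk :: "'m::finite \<Rightarrow> nat"
    and g :: "real ^ 'm \<Rightarrow> real"
    and \<psi> :: "nat \<Rightarrow> (real ^ 'n::finite) \<times> (real ^ 'm) \<Rightarrow> real ^ 'm"
    and lam Kg \<epsilon> :: real
    and \<beta> K :: "nat \<Rightarrow> real"
    and \<Theta> :: "(real ^ 'n) \<times> (real ^ 'm) \<Rightarrow> real"
    and z0 :: "(real ^ 'n) \<times> (real ^ 'm)"
  assumes blocks: "range blk = {1..L}"
    and g_nonneg: "\<And>u. g u \<ge> 0"
    and g_lip: "locally_lipschitz_on UNIV g"
    and g_diff: "twice_dir_differentiable_on UNIV g"
    and psi_range: "\<And>l z. l \<in> {1..L} \<Longrightarrow> z \<in> pre_space blk (l - 1) \<Longrightarrow> \<psi> (l - 1) z \<in> block_space blk l"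
    and psi_lip: "\<And>l. l \<in> {1..L} \<Longrightarrow> locally_lipschitz_on (pre_space blk (l - 1)) (\<psi> (l - 1))"
    and psi_diff: "\<And>l. l \<in> {1..L} \<Longrightarrow> twice_dir_differentiable_on (pre_space blk (l - 1)) (\<psi> (l - 1))"
    and lam_pos: "lam > 0"
    and beta_pos: "\<And>l. l \<in> {1..L} \<Longrightarrow> \<beta> l > 0"
    and Theta: "\<Theta> = penalized L blk g \<psi> lam \<beta>"
    and z0: "z0 = (0, forward \<psi> L)"
    and g_convex: "convex_on UNIV g"
    and Kg_pos: "Kg > 0"
    and K_pos: "\<And>l. l \<in> {1..L - 1} \<Longrightarrow> K l > 0"
    and Kg: "\<And>\<theta> u d d'. (\<theta>, u) \<in> lev \<Theta> (\<Theta> z0) \<Longrightarrow> fst d = (fst d' :: real ^ 'n) \<Longrightarrow>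
        \<bar>dir_deriv g u (snd d) - dir_deriv g u (snd d')\<bar> \<le> Kg * norm (snd d - snd d')"
    and K: "\<And>\<theta> u d d' l. (\<theta>, u) \<in> lev \<Theta> (\<Theta> z0) \<Longrightarrow> fst d = fst d' \<Longrightarrow> l \<in> {2..L} \<Longrightarrow>
        norm (dir_deriv (\<psi> (l - 1)) (\<theta>, pre blk (l - 1) u) (fst d, pre blk (l - 1) (snd d))
            - dir_deriv (\<psi> (l - 1)) (\<theta>, pre blk (l - 1) u) (fst d', pre blk (l - 1) (snd d')))
          \<le> K (l - 1) * norm (pre blk (l - 1) (snd d) - pre blk (l - 1) (snd d'))"
    and beta: "\<And>l. l \<in> {1..L} \<Longrightarrow> \<beta> l > (Kg + 1) * (\<Prod>j=l+1..L. 1 + K (j - 1))"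
    and eps: "0 \<le> \<epsilon>" "\<epsilon> < 1"
  shows "D1 \<Theta> \<epsilon> \<inter> lev \<Theta> (\<Theta> z0) \<subseteq> SD1 \<Theta> \<epsilon>"
proof
  fix z assume "z \<in> D1 \<Theta> \<epsilon> \<inter> lev \<Theta> (\<Theta> z0)"
  moreover obtain \<theta> u where z: "z = (\<theta>, u)" by fastforce
  ultimately have D1: "(\<theta>, u) \<in> D1 \<Theta> \<epsilon>" and lev: "(\<theta>, u) \<in> lev \<Theta> (\<Theta> z0)" by auto
  \<comment> \<open>With the parameter part \<open>a\<close> of the direction fixed, the linearized
    constraints form a triangular system in the remaining blocks.\<close>
  define \<psi>' where "\<psi>' a l x = dir_deriv (\<psi> (l - 1)) (\<theta>, pre blk (l - 1) u) (a, x)" for a l x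
  define w where "w l = block blk l u - \<psi> (l - 1) (\<theta>, pre blk (l - 1) u)" for l
  define P where "P l = (\<Prod>j=l+1..L. 1 + K (j - 1))" for l
  have w_block: "w l \<in> block_space blk l" if "l \<in> {1..L}" for l
    unfolding w_def
    by (intro subspace_diff subspace_block_space block_in_block_space psi_range[OF that] pre_in_pre_space)
  have \<psi>'_lim: "(dir_quot (\<psi> (l - 1)) (\<theta>, pre blk (l - 1) u) (a, pre blk (l - 1) v)
      \<longlongrightarrow> \<psi>' a l (pre blk (l - 1) v)) (at_right 0)" if "l \<in> {1..L}" for a l v
    unfolding \<psi>'_def by (rule tendsto_dir_deriv[OF psi_diff[OF that]]) (rule pre_in_pre_space)+
  have \<psi>'_block: "\<psi>' a l (pre blk (l - 1) v) \<in> block_space blk l" if "l \<in> {1..L}" for a l v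
    by (rule dir_deriv_in_block_space[OF \<psi>'_lim[OF that], of "pre_space blk (l - 1)"])
      (fact psi_range[OF that] subspace_pre_space pre_in_pre_space)+
  have \<psi>'_lip: "norm (\<psi>' a l (pre blk (l - 1) v) - \<psi>' a l (pre blk (l - 1) v'))
      \<le> K (l - 1) * norm (pre blk (l - 1) v - pre blk (l - 1) v')" if "l \<in> {2..L}" for a l v v'
    using K[OF lev _ that, of "(a, v)" "(a, v')"] by (simp add: \<psi>'_def)
  have g'_lip: "\<bar>dir_deriv g u v - dir_deriv g u v'\<bar> \<le> Kg * norm (v - v')" for v v'
    using Kg[OF lev, of "(0, v)" "(0, v')"] by simp
  have stable: "norm (v - v') \<le> (\<Sum>l=1..L. P l * norm ((block blk l v - \<psi>' a l (pre blk (l - 1) v)) -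
      (block blk l v' - \<psi>' a l (pre blk (l - 1) v'))))" for a v v'
    unfolding P_def using K_pos \<psi>'_lip
    by (intro triangular_system_stable[OF blocks]) (auto simp: less_imp_le)
  have \<Theta>'_lim: "(dir_quot \<Theta> (\<theta>, u) (a, v) \<longlongrightarrow>
    dir_deriv g u v + lam * (2 * (\<theta> \<bullet> a)) + (\<Sum>l=1..L. \<beta> l * (\<Sum>i\<in>UNIV.
      let w = w l $ i; \<rho> = (block blk l v - \<psi>' a l (pre blk (l - 1) v)) $ i
      in if w = 0 then \<bar>\<rho>\<bar> else sgn w * \<rho>))) (at_right 0)" for a v
    unfolding Theta w_def
    by (intro tendsto_dir_quot_penalized tendsto_dir_deriv[OF g_diff] \<psi>'_lim UNIV_I)
  note \<Theta>'_eq = dir_deriv_unique[OF \<Theta>'_lim]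
  note \<Theta>'_ge = D1_lower_bound[OF D1 \<Theta>'_lim]
  \<comment> \<open>Serves feasibility and tangency alike, with \<open>s\<close> the length of a
    correction. Bounding \<open>\<epsilon>\<close> by 1 produces the constant \<open>Kg + 1\<close>
    that \<open>\<beta>\<close> exceeds.\<close>
  have exact: "\<forall>l\<in>{1..L}. r l = 0"
    if "(\<Sum>l=1..L. \<beta> l * l1_norm (r l)) \<le> (Kg + \<epsilon>) * s"
      and "0 \<le> s" "s \<le> (\<Sum>l=1..L. P l * norm (r l))" for r :: "nat \<Rightarrow> real ^ 'm" and s
  proof -
    have "(Kg + \<epsilon>) * s \<le> (Kg + 1) * (\<Sum>l=1..L. P l * norm (r l))"
      using that eps Kg_pos by (intro mult_mono) auto
    with that(1) have "(\<Sum>l=1..L. \<beta> l * l1_norm (r l)) \<le> (\<Sum>l=1..L. ((Kg + 1) * P l) * norm (r l))"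
      by (simp add: sum_distrib_left mult.assoc)
    moreover have "(Kg + 1) * P l < \<beta> l" if "l \<in> {1..L}" for l
      using beta[OF that] by (simp add: P_def)
    ultimately show ?thesis
      using beta_pos by (intro ballI l1_penalty_dominates[of "{1..L}" "\<lambda>l. (Kg + 1) * P l" \<beta>])
        (auto simp: less_imp_le)
  qed
  have w0: "w l = 0" if "l \<in> {1..L}" for l
  proof -
    \<comment> \<open>the direction that shrinks every residual at unit relative rate while \<open>\<theta>\<close> is fixed\<close>
    have "\<psi>' 0 l (pre blk (l - 1) x) - w l \<in> block_space blk l" if "l \<in> {1..L}" for l x
      by (intro subspace_diff subspace_block_space \<psi>'_block w_block that)
    then obtain v where v: "\<And>l. l \<in> {1..L} \<Longrightarrow> block blk l v = \<psi>' 0 l (pre blk (l - 1) v) - w l"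
      using triangular_system_solvable[of L "\<lambda>l x. \<psi>' 0 l x - w l" blk] by blast
    \<comment> \<open>The linearized residual of \<open>v\<close> is \<open>- w l\<close>:
      coordinates with zero residual contribute nothing, the others minus their absolute
      value.\<close>
    have "(\<Sum>l=1..L. \<beta> l * (\<Sum>i\<in>UNIV.
      let w = w l $ i; \<rho> = (block blk l v - \<psi>' 0 l (pre blk (l - 1) v)) $ i
      in if w = 0 then \<bar>\<rho>\<bar> else sgn w * \<rho>)) = (\<Sum>l=1..L. - (\<beta> l * l1_norm (w l)))"
    proof (rule sum.cong)
      fix l assume l: "l \<in> {1..L}"
      show "\<beta> l * (\<Sum>i\<in>UNIV. let w = w l $ i; \<rho> = (block blk l v - \<psi>' 0 l (pre blk (l - 1) v)) $ i
        in if w = 0 then \<bar>\<rho>\<bar> else sgn w * \<rho>) = - (\<beta> l * l1_norm (w l))"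
        unfolding v[OF l] l1_norm_def mult_minus_right[symmetric] sum_negf[symmetric]
        by (intro arg_cong2[where f = times] sum.cong) (auto simp: Let_def sgn_if)
    qed simp
    then have "dir_deriv \<Theta> (\<theta>, u) (0, v) = dir_deriv g u v - (\<Sum>l=1..L. \<beta> l * l1_norm (w l))"
      by (simp add: \<Theta>'_eq sum_negf)
    moreover have "dir_deriv g u v \<le> Kg * norm v"
      using g'_lip[of v 0] by simp
    ultimately have "(\<Sum>l=1..L. \<beta> l * l1_norm (w l)) \<le> (Kg + \<epsilon>) * norm v"
      using \<Theta>'_ge[of 0 v] by (simp add: norm_Pair algebra_simps)
    moreover have "norm v \<le> (\<Sum>l=1..L. P l * norm (w l))"
    proof -
      \<comment> \<open>The zero direction has zero linearized residuals, so comparing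
        \<open>v\<close> with it bounds \<open>norm v\<close>.\<close>
      have "block blk l 0 - \<psi>' 0 l (pre blk (l - 1) 0) = 0" for l
      proof -
        have "block blk l 0 = 0" "pre blk (l - 1) 0 = 0"
          by (simp_all add: block_def pre_def vec_eq_iff)
        then show ?thesis by (simp add: \<psi>'_def flip: zero_prod_def)
      qed
      with stable[of v 0 0] v show ?thesis by simp
    qed
    ultimately have "\<forall>l\<in>{1..L}. w l = 0" by (rule exact[OF _ norm_ge_zero])
    with that show ?thesis by blast
  qed
  have feasible: "block blk l u = \<psi> (l - 1) (\<theta>, pre blk (l - 1) u)" if "l \<in> {1..L}" for l
    using w0[OF that] by (simp add: w_def)
  \<comment> \<open>At a feasible point every coordinate falls into the absolute-value
    branch.\<close>
  have \<Theta>': "dir_deriv \<Theta> (\<theta>, u) (a, v) = dir_deriv g u v + lam * (2 * (\<theta> \<bullet> a)) +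
      (\<Sum>l=1..L. \<beta> l * l1_norm (block blk l v - \<psi>' a l (pre blk (l - 1) v)))" for a v
    by (simp add: \<Theta>'_eq w0 l1_norm_def)
  have "- \<epsilon> \<le> dir_deriv2 \<Theta> (\<theta>, u) (a, v)"
    if d: "norm (a, v) = 1" and eq: "dir_deriv \<Theta> (\<theta>, u) (a, v) = - \<epsilon>" for a v
  proof -
    define r where "r l = block blk l v - \<psi>' a l (pre blk (l - 1) v)" for l
    \<comment> \<open>The tangent correction of \<open>v\<close> with the same parameter part
      \<open>a\<close>.\<close>
    obtain v' where v': "\<And>l. l \<in> {1..L} \<Longrightarrow> block blk l v' = \<psi>' a l (pre blk (l - 1) v')"
      using triangular_system_solvable[of L "\<psi>' a" blk] \<psi>'_block by blast
    have "norm (a, v') \<le> norm (a, v) + norm ((a, v') - (a, v))"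
      by (metis norm_triangle_sub)
    also have "\<dots> = 1 + norm (v - v')"
      unfolding d by (simp add: norm_Pair norm_minus_commute)
    finally have "- \<epsilon> * (1 + norm (v - v')) \<le> - \<epsilon> * norm (a, v')"
      using eps by (simp add: mult_left_mono)
    also have "\<dots> \<le> dir_deriv \<Theta> (\<theta>, u) (a, v')" by (rule \<Theta>'_ge)
    \<comment> \<open>Passing from \<open>v\<close> to \<open>v'\<close> keeps the regularization
      term and removes the whole penalty term.\<close>
    also have "\<dots> = - \<epsilon> + (dir_deriv g u v' - dir_deriv g u v) - (\<Sum>l=1..L. \<beta> l * l1_norm (r l))"
      using eq v' by (simp add: \<Theta>' r_def l1_norm_def)
    also have "\<dots> \<le> - \<epsilon> + Kg * norm (v - v') - (\<Sum>l=1..L. \<beta> l * l1_norm (r l))"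
      using g'_lip[of v v'] by simp
    finally have "(\<Sum>l=1..L. \<beta> l * l1_norm (r l)) \<le> (Kg + \<epsilon>) * norm (v - v')"
      by (simp add: algebra_simps)
    moreover have "norm (v - v') \<le> (\<Sum>l=1..L. P l * norm (r l))"
      using stable[of v v' a] v' by (simp add: r_def)
    ultimately have "\<forall>l\<in>{1..L}. r l = 0" by (rule exact[OF _ norm_ge_zero])
    then have tangent: "block blk l v = \<psi>' a l (pre blk (l - 1) v)" if "l \<in> {1..L}" for l
      using that by (simp add: r_def)
    have "dir_deriv2 \<Theta> (\<theta>, u) (a, v) = dir_deriv2 g u v + lam * (2 * (a \<bullet> a)) +
      (\<Sum>l=1..L. \<beta> l * l1_norm (dir_deriv2 (\<psi> (l - 1)) (\<theta>, pre blk (l - 1) u) (a, pre blk (l - 1) v)))"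
      unfolding Theta using tangent unfolding \<psi>'_def
      by (intro dir_deriv2_unique tendsto_dir_quot2_penalized g_diff psi_diff feasible)
    moreover have "0 \<le> dir_deriv2 g u v"
      by (rule convex_on_dir_deriv2_nonneg[OF g_convex g_diff])
    moreover have "0 \<le> (\<Sum>l=1..L. \<beta> l *
        l1_norm (dir_deriv2 (\<psi> (l - 1)) (\<theta>, pre blk (l - 1) u) (a, pre blk (l - 1) v)))"
      using beta_pos by (intro sum_nonneg mult_nonneg_nonneg l1_norm_nonneg) (simp add: less_imp_le)
    moreover have "0 \<le> lam * (2 * (a \<bullet> a))"
      using lam_pos by simp
    \<comment> \<open>The second derivative is even nonnegative.\<close>
    ultimately show ?thesis using eps by linarith
  qed
  with D1 show "z \<in> SD1 \<Theta> \<epsilon>"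
    by (auto simp: SD1_def z)
qed

end
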